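(* Let $\varphi_e$ and $\varphi_{e_1}$ be two ruled surfaces in $\mathbb{R}^3$ that form a Bertrand surface offset, with offset angle $\theta$ and offset distance $\theta^*$. Then the dual conical curvature $\bar\gamma_1$ of $\varphi_{e_1}$ is expressed through the invariants $\gamma,\delta,\Delta$ of $\varphi_e$ (at corresponding parameters) by $$\begin{aligned}\bar\gamma_1=\;&\frac{ds}{ds_1}(\gamma\cos\theta-\sin\theta)+\varepsilon\,\frac{ds}{ds_1}\bigg[\left(\frac{ds}{ds_1}\cos\theta\,(\sin\theta-\gamma\cos\theta)-\sin\theta\right)\Delta\\&+\left(\cos\theta-\frac{ds}{ds_1}\sin\theta\,(\gamma\cos\theta-\sin\theta)\right)\delta\\&-\left(\frac{ds}{ds_1}(\gamma\cos\theta-\sin\theta)^2+\cos\theta+\gamma\sin\theta\right)\theta^*\bigg].\end{aligned}$$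
   Context: Dual numbers are $\bar a=a+\varepsilon a^*$ with $a,a^*\in\mathbb{R}$, $\varepsilon\neq 0$, $\varepsilon^2=0$. For a differentiable real function $f$, $f(x+\varepsilon x^* )=f(x)+\varepsilon x^*f'(x)$; e.g. $\cos(x+\varepsilon x^* )=\cos x-\varepsilon x^*\sin x$, $\sin(x+\varepsilon x^* )=\sin x+\varepsilon x^*\cos x$. Dual vectors are $\tilde a=\vec a+\varepsilon\vec a^*$ with $\vec a,\vec a^*\in\mathbb{R}^3$; scalar and vector products are extended $\varepsilon$-bilinearly. A ruled surface $\varphi_e=\vec c(s)+v\,\vec e(s)$ (all data smooth) is parametrized so that $\langle \vec e,\vec e\rangle=1$, $\langle \vec e',\vec e'\rangle=1$, $\langle \vec c',\vec e'\rangle=0$, where prime is $d/ds$; so $s$ is the arc length of the real indicatrix $\vec e(s)$ and $\vec c$ is the striction line. It is represented by the dual unit vector $\tilde e=\vec e+\varepsilon\,\vec c\times\vec e$. Put $\vec t=\vec e'$, $\vec g=\vec e\times\vec t$; the conical curvature $\gamma$ is defined by $\vec e'=\vec t$, $\vec t'=\gamma\vec g-\vec e$, $\vec g'=-\gamma\vec t$. Put $\Delta=\det(\vec c',\vec e,\vec t)$, $\delta=\langle\vec c',\vec e\rangle$. The dual Darboux frame is $\{\tilde e,\tilde t,\tilde g\}$ with $\tilde t=\vec t+\varepsilon\,\vec c\times\vec t$, $\tilde g=\vec g+\varepsilon\,\vec c\times\vec g$. The dual conical curvature is $\bar\gamma=\gamma+\varepsilon(\delta-\gamma\Delta)$. The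 corresponding objects of a second ruled surface $\varphi_{e_1}$ (with its own parameter $s_1$, derivatives taken with respect to $s_1$) carry the subscript $1$; so $\bar\gamma_1=\gamma_1+\varepsilon(\delta_1-\gamma_1\Delta_1)$. $\varphi_e$ and $\varphi_{e_1}$ form a Bertrand surface offset if, under a correspondence $s_1=s_1(s)$ between their rulings (differentiable with nonvanishing derivative), $\tilde t=\tilde t_1$ at corresponding parameters. The frames are then related by $\tilde e_1=\cos\bar\theta\,\tilde e-\sin\bar\theta\,\tilde g$, $\tilde t_1=\tilde t$, $\tilde g_1=\sin\bar\theta\,\tilde e+\cos\bar\theta\,\tilde g$, where $\bar\theta=\theta+\varepsilon\theta^*$ ($0\le\theta\le\pi$, $\theta^*\in\mathbb{R}$) is the dual angle between $\tilde e$ and $\tilde e_1$; $\theta$ is the offset angle and $\theta^*$ the offset distance. $ds/ds_1$ is the derivative of the inverse correspondence $s=s(s_1)$. *)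

theory Defs
  imports "HOL-Analysis.Analysis"
begin

text \<open>
  \<open>Dual a b\<close> stands for $a + \varepsilon b$: over \<open>real\<close> it is a dual number, over
  \<open>real ^ 3\<close> a dual vector.
\<close>

datatype 'a dual = Dual (re_part: 'a) (du_part: 'a)

instantiation dual :: (minus) minus
begin

definition minus_dual :: "'a dual \<Rightarrow> 'a dual \<Rightarrow> 'a dual" where
  "x - y = Dual (re_part x - re_part y) (du_part x - du_part y)"

instance ..

end

text \<open>The product $(a + \varepsilon a^*)(x + \varepsilon x^*)$ with $\varepsilon^2 = 0$.\<close>

definition dual_scale :: "real dual \<Rightarrow> 'v::real_vector dual \<Rightarrow> 'v dual" (infixr "*\<^sub>D" 75) where
  "a *\<^sub>D x = Dual (re_part a *\<^sub>R re_part x) (re_part a *\<^sub>R du_part x + du_part a *\<^sub>R re_part x)"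

text \<open>The extension of a differentiable real function to dual arguments.\<close>

definition dual_ext :: "(real \<Rightarrow> real) \<Rightarrow> real dual \<Rightarrow> real dual" where
  "dual_ext f x = Dual (f (re_part x)) (du_part x * deriv f (re_part x))"

abbreviation vderiv :: "(real \<Rightarrow> real ^ 3) \<Rightarrow> real \<Rightarrow> real ^ 3" where
  "vderiv f \<equiv> \<lambda>s. vector_derivative f (at s)"

text \<open>Used on open sets only, where it says that \<open>f\<close> has derivatives of all orders.\<close>

definition smooth_on :: "real set \<Rightarrow> (real \<Rightarrow> real ^ 3) \<Rightarrow> bool" where
  "smooth_on I f \<longleftrightarrow> (\<forall>n. \<forall>s\<in>I. (vderiv ^^ n) f differentiable (at s))"

text \<open>
  A ruled surface $\vec c(s) + v\,\vec e(s)$, for \<open>s\<close> in an open interval \<open>I\<close>, is given by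
  the pair \<open>c\<close>, \<open>e\<close>, parametrized by the arc length of \<open>e\<close> and with striction line \<open>c\<close>.
\<close>

definition ruled_surface :: "real set \<Rightarrow> (real \<Rightarrow> real ^ 3) \<Rightarrow> (real \<Rightarrow> real ^ 3) \<Rightarrow> bool" where
  "ruled_surface I c e \<longleftrightarrow>
     open I \<and> is_interval I \<and> smooth_on I c \<and> smooth_on I e \<and>
     (\<forall>s\<in>I. e s \<bullet> e s = 1 \<and> vderiv e s \<bullet> vderiv e s = 1 \<and> vderiv c s \<bullet> vderiv e s = 0)"

definition tvec :: "(real \<Rightarrow> real ^ 3) \<Rightarrow> real \<Rightarrow> real ^ 3" where
  "tvec e = vderiv e"

definition gvec :: "(real \<Rightarrow> real ^ 3) \<Rightarrow> real \<Rightarrow> real ^ 3" where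
  "gvec e s = cross3 (e s) (tvec e s)"

text \<open>The conical curvature is the coefficient determined by the Frenet-type equations of the frame.\<close>

definition conical_curvature :: "(real \<Rightarrow> real ^ 3) \<Rightarrow> real \<Rightarrow> real" where
  "conical_curvature e s =
     (THE k. vderiv (tvec e) s = k *\<^sub>R gvec e s - e s \<and> vderiv (gvec e) s = - k *\<^sub>R tvec e s)"

definition big_Delta :: "(real \<Rightarrow> real ^ 3) \<Rightarrow> (real \<Rightarrow> real ^ 3) \<Rightarrow> real \<Rightarrow> real" where
  "big_Delta c e s = det (vector [vderiv c s, e s, tvec e s] :: real ^ 3 ^ 3)"

definition small_delta :: "(real \<Rightarrow> real ^ 3) \<Rightarrow> (real \<Rightarrow> real ^ 3) \<Rightarrow> real \<Rightarrow> real" where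
  "small_delta c e s = vderiv c s \<bullet> e s"

definition dual_conical_curvature ::
    "(real \<Rightarrow> real ^ 3) \<Rightarrow> (real \<Rightarrow> real ^ 3) \<Rightarrow> real \<Rightarrow> real dual" where
  "dual_conical_curvature c e s =
     Dual (conical_curvature e s) (small_delta c e s - conical_curvature e s * big_Delta c e s)"

text \<open>The dual vector of the line through \<open>p\<close> with direction \<open>x\<close>.\<close>

definition dual_line :: "real ^ 3 \<Rightarrow> real ^ 3 \<Rightarrow> (real ^ 3) dual" where
  "dual_line p x = Dual x (cross3 p x)"

definition dual_e :: "(real \<Rightarrow> real ^ 3) \<Rightarrow> (real \<Rightarrow> real ^ 3) \<Rightarrow> real \<Rightarrow> (real ^ 3) dual" where
  "dual_e c e s = dual_line (c s) (e s)"

definition dual_t :: "(real \<Rightarrow> real ^ 3) \<Rightarrow> (real \<Rightarrow> real ^ 3) \<Rightarrow> real \<Rightarrow> (real ^ 3) dual" where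
  "dual_t c e s = dual_line (c s) (tvec e s)"

definition dual_g :: "(real \<Rightarrow> real ^ 3) \<Rightarrow> (real \<Rightarrow> real ^ 3) \<Rightarrow> real \<Rightarrow> (real ^ 3) dual" where
  "dual_g c e s = dual_line (c s) (gvec e s)"

text \<open>\<open>\<sigma>\<close> is the correspondence $s_1 = s_1(s)$ between the rulings.\<close>

definition bertrand_offset ::
    "real set \<Rightarrow> (real \<Rightarrow> real ^ 3) \<Rightarrow> (real \<Rightarrow> real ^ 3) \<Rightarrow>
     real set \<Rightarrow> (real \<Rightarrow> real ^ 3) \<Rightarrow> (real \<Rightarrow> real ^ 3) \<Rightarrow> (real \<Rightarrow> real) \<Rightarrow> bool" where
  "bertrand_offset I c e I\<^sub>1 c\<^sub>1 e\<^sub>1 \<sigma> \<longleftrightarrow>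
     bij_betw \<sigma> I I\<^sub>1 \<and>
     (\<forall>s\<in>I. \<sigma> field_differentiable (at s) \<and> deriv \<sigma> s \<noteq> 0) \<and>
     (\<forall>s\<in>I. dual_t c e s = dual_t c\<^sub>1 e\<^sub>1 (\<sigma> s))"

text \<open>
  \<open>\<theta> + \<epsilon> \<theta>'\<close> is the dual angle from the first surface to its offset. It may depend on the
  ruling a priori. The relation for the third frame vector,
  $\tilde g_1 = \sin\bar\theta\,\tilde e + \cos\bar\theta\,\tilde g$, is not required separately:
  it follows from the one for $\tilde e_1$ by taking the vector product with
  $\tilde t_1 = \tilde t$.
\<close>

definition offset_dual_angle ::
    "real set \<Rightarrow> (real \<Rightarrow> real ^ 3) \<Rightarrow> (real \<Rightarrow> real ^ 3) \<Rightarrow>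
     (real \<Rightarrow> real ^ 3) \<Rightarrow> (real \<Rightarrow> real ^ 3) \<Rightarrow> (real \<Rightarrow> real) \<Rightarrow>
     (real \<Rightarrow> real) \<Rightarrow> (real \<Rightarrow> real) \<Rightarrow> bool" where
  "offset_dual_angle I c e c\<^sub>1 e\<^sub>1 \<sigma> \<theta> \<theta>' \<longleftrightarrow>
     (\<forall>s\<in>I. 0 \<le> \<theta> s \<and> \<theta> s \<le> pi \<and>
        dual_e c\<^sub>1 e\<^sub>1 (\<sigma> s) =
          dual_ext cos (Dual (\<theta> s) (\<theta>' s)) *\<^sub>D dual_e c e s
        - dual_ext sin (Dual (\<theta> s) (\<theta>' s)) *\<^sub>D dual_g c e s)"

end

theory Submission
  imports Defs
begin

text \<open>
  Along the offset, equality of the dual vectors $\tilde t = \tilde t_1$ says that the oriented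
  lines through $\vec c$ and through $\vec c_1$ with the common direction $\vec t = \vec t_1$
  coincide. Hence $\vec c_1 - \vec c$ is a multiple of $\vec t$, and the dual part of the relation
  for $\tilde e_1$ identifies the factor as $\theta^*$. So at corresponding parameters
  \[ \vec c_1 = \vec c + \theta^*\,\vec t, \qquad \vec t_1 = \vec t. \]

  Differentiate both relations by $s$, writing $\sigma' = ds_1/ds$, and take scalar products with
  $\vec e_1 = \cos\theta\,\vec e - \sin\theta\,\vec g$ and
  $\vec g_1 = \sin\theta\,\vec e + \cos\theta\,\vec g$. For every ruled surface
  $\delta = \langle \vec c', \vec e\rangle$, $\Delta = \langle \vec c', \vec g\rangle$ and
  $\gamma = \langle \vec t', \vec g\rangle$. So the left-hand side of the first relation becomes
  $\sigma'\delta_1$ and $\sigma'\Delta_1$, and that of the second, multiplied by $\vec g_1$,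
  becomes $\sigma'\gamma_1$. The right-hand sides follow from
  $\langle \vec t', \vec e\rangle = -1$; the term with the derivative of $\theta^*$ is a multiple
  of $\vec t$ and hence orthogonal to $\vec e_1$ and $\vec g_1$. Since $ds/ds_1 = 1/\sigma'$, this
  expresses $\gamma_1$, $\delta_1$ and $\Delta_1$ through the invariants of the first surface, and
  the theorem is the value of $\gamma_1 + \varepsilon(\delta_1 - \gamma_1\Delta_1)$.
\<close>

section \<open>Derivatives of products and of inverse functions\<close>

lemma bounded_bilinear_cross3: "bounded_bilinear cross3"
  using bilinear_cross by (simp add: bilinear_conv_bounded_bilinear)

lemma inner_deriv_eq_0_if_constant:
  fixes f g :: "real \<Rightarrow> 'a::real_inner"
  assumes "open S" "s \<in> S" "\<And>x. x \<in> S \<Longrightarrow> f x \<bullet> g x = k"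
    and "(f has_vector_derivative f') (at s)" "(g has_vector_derivative g') (at s)"
  shows "f s \<bullet> g' + f' \<bullet> g s = 0"
proof -
  have "((\<lambda>x. f x \<bullet> g x) has_vector_derivative f s \<bullet> g' + f' \<bullet> g s) (at s)"
    by (rule bounded_bilinear.has_vector_derivative[OF bounded_bilinear_inner assms(4,5)])
  moreover have "((\<lambda>x. f x \<bullet> g x) has_vector_derivative 0) (at s)"
    by (rule has_vector_derivative_transform_within_open[OF has_vector_derivative_const assms(1,2)])
      (simp add: assms(3))
  ultimately show ?thesis
    by (rule vector_derivative_unique_at)
qed

lemma deriv_inv_into_open:
  fixes f :: "real \<Rightarrow> real"
  assumes "open S" "s \<in> S" "inj_on f S"
    and "\<And>x. x \<in> S \<Longrightarrow> f field_differentiable (at x)" "deriv f s \<noteq> 0"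
  shows "deriv (inv_into S f) (f s) = inverse (deriv f s)"
proof (rule DERIV_imp_deriv)
  have "continuous_on S f"
    using assms(4) by (meson continuous_at_imp_continuous_on field_differentiable_imp_continuous_at)
  moreover have "(f has_derivative (*) (deriv f s)) (at s)"
    using assms(2,4) by (simp add: field_differentiable_derivI flip: has_field_derivative_def)
  moreover have "(*) (deriv f s) \<circ> (*) (inverse (deriv f s)) = id"
    using assms(5) by (simp add: fun_eq_iff)
  ultimately show "(inv_into S f has_field_derivative inverse (deriv f s)) (at (f s))"
    unfolding has_field_derivative_def
    using has_derivative_inverse_strong[OF assms(1,2)] inv_into_f_f[OF assms(3)] by blast
qed

section \<open>Orthonormal frames in space\<close>

lemma parallel_if_cross3_eq_0:
  fixes x u :: "real ^ 3"
  assumes "cross3 x u = 0" "u \<bullet> u = 1"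
  shows "x = (x \<bullet> u) *\<^sub>R u"
  using Lagrange[of u x u] assms by (simp add: inner_commute)

lemma orthonormal_cross3:
  fixes u v :: "real ^ 3"
  assumes "u \<bullet> u = 1" "v \<bullet> v = 1" "u \<bullet> v = 0"
  shows "cross3 u v \<bullet> cross3 u v = 1"
    and "cross3 v (cross3 u v) = u"
    and "cross3 u (cross3 u v) = - v"
proof -
  show "cross3 v (cross3 u v) = u" "cross3 u (cross3 u v) = - v"
    using assms by (simp_all add: Lagrange inner_commute)
  then show "cross3 u v \<bullet> cross3 u v = 1"
    using cross_triple[of u v "cross3 u v"] assms by simp
qed

text \<open>
  With \<open>g = u \<times> v\<close>, the rest \<open>x - (x \<bullet> g) g\<close> is \<open>g \<times> (x \<times> g)\<close>, and the triple product
  \<open>x \<times> (u \<times> v)\<close> already is a combination of \<open>u\<close> and \<open>v\<close>.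
\<close>

lemma orthonormal_expansion:
  fixes u v x :: "real ^ 3"
  assumes "u \<bullet> u = 1" "v \<bullet> v = 1" "u \<bullet> v = 0"
  shows "x = (x \<bullet> u) *\<^sub>R u + (x \<bullet> v) *\<^sub>R v + (x \<bullet> cross3 u v) *\<^sub>R cross3 u v"
proof -
  let ?g = "cross3 u v"
  have "cross3 x ?g = (x \<bullet> v) *\<^sub>R u - (x \<bullet> u) *\<^sub>R v"
    by (simp add: Lagrange)
  then have "cross3 ?g (cross3 x ?g) = (x \<bullet> v) *\<^sub>R cross3 ?g u - (x \<bullet> u) *\<^sub>R cross3 ?g v"
    by (simp add: Cross3.right_diff_distrib cross_mult_right)
  also have "\<dots> = (x \<bullet> v) *\<^sub>R v + (x \<bullet> u) *\<^sub>R u"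
    using orthonormal_cross3(2,3)[OF assms]
    by (simp add: cross_skew[of ?g u] cross_skew[of ?g v])
  finally show ?thesis
    using Lagrange[of ?g x ?g] orthonormal_cross3(1)[OF assms]
    by (simp add: inner_commute algebra_simps)
qed

section \<open>The Darboux frame of a ruled surface\<close>

lemma ruled_surface_frame:
  assumes "ruled_surface I c e" "s \<in> I"
  shows "e s \<bullet> e s = 1" "tvec e s \<bullet> tvec e s = 1"
    and "e s \<bullet> tvec e s = 0" "gvec e s \<bullet> gvec e s = 1"
    and "vderiv (tvec e) s \<bullet> tvec e s = 0" "vderiv (tvec e) s \<bullet> e s = - 1"
    and "(c has_vector_derivative vderiv c s) (at s)"
    and "(e has_vector_derivative tvec e s) (at s)"
    and "(tvec e has_vector_derivative vderiv (tvec e) s) (at s)"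
proof -
  have I: "open I"
    using assms(1) by (simp add: ruled_surface_def)
  have ee: "e x \<bullet> e x = 1" and tt: "tvec e x \<bullet> tvec e x = 1"
    and de: "(e has_vector_derivative tvec e x) (at x)" if "x \<in> I" for x
    using assms(1) that unfolding ruled_surface_def smooth_on_def tvec_def
      vector_derivative_works[symmetric] by (simp, simp, metis funpow_0)
  show "e s \<bullet> e s = 1" "tvec e s \<bullet> tvec e s = 1"
    and de_s: "(e has_vector_derivative tvec e s) (at s)"
    using ee tt de assms(2) by auto
  show "(c has_vector_derivative vderiv c s) (at s)"
    using assms unfolding ruled_surface_def smooth_on_def vector_derivative_works[symmetric]
    by (metis funpow_0)
  have "((vderiv ^^ 1) e) differentiable (at s)"
    using assms unfolding ruled_surface_def smooth_on_def by blast
  then show dt: "(tvec e has_vector_derivative vderiv (tvec e) s) (at s)"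
    by (simp add: tvec_def vector_derivative_works)
  have et: "e x \<bullet> tvec e x = 0" if "x \<in> I" for x
    using inner_deriv_eq_0_if_constant[OF I that ee de[OF that] de[OF that]]
    by (simp add: inner_commute)
  then show "e s \<bullet> tvec e s = 0"
    using assms(2) by simp
  show "gvec e s \<bullet> gvec e s = 1"
    unfolding gvec_def using ee tt et assms(2) by (intro orthonormal_cross3) auto
  show "vderiv (tvec e) s \<bullet> tvec e s = 0"
    using inner_deriv_eq_0_if_constant[OF I assms(2) tt dt dt]
    by (simp add: inner_commute)
  show "vderiv (tvec e) s \<bullet> e s = - 1"
    using inner_deriv_eq_0_if_constant[OF I assms(2) et de_s dt]
      tt[OF assms(2)] by (simp add: inner_commute)
qed

text \<open>
  Expanding \<open>t'\<close> in the frame gives the first Frenet equation, with no component along \<open>t\<close>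
  because \<open>t\<close> has unit length; the second one is its vector product with \<open>e\<close>. So the
  conical curvature exists, and it must be the \<open>g\<close>-component of \<open>t'\<close>.
\<close>

lemma conical_curvature_eq_inner:
  assumes "ruled_surface I c e" "s \<in> I"
  shows "conical_curvature e s = vderiv (tvec e) s \<bullet> gvec e s"
  unfolding conical_curvature_def
proof (rule the_equality)
  note frame = ruled_surface_frame[OF assms]
  let ?k = "vderiv (tvec e) s \<bullet> gvec e s"
  show "vderiv (tvec e) s = k *\<^sub>R gvec e s - e s \<and> vderiv (gvec e) s = - k *\<^sub>R tvec e s
      \<Longrightarrow> k = ?k" for k
    using frame(4) by (simp add: inner_diff_left gvec_def dot_cross_self)
  have t': "vderiv (tvec e) s = ?k *\<^sub>R gvec e s - e s"
    using orthonormal_expansion[OF frame(1,2,3), of "vderiv (tvec e) s"] frame(5,6)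
    by (simp add: gvec_def)
  have "((\<lambda>x. cross3 (e x) (tvec e x)) has_vector_derivative
      cross3 (e s) (vderiv (tvec e) s) + cross3 (tvec e s) (tvec e s)) (at s)"
    by (rule bounded_bilinear.has_vector_derivative[OF bounded_bilinear_cross3 frame(8,9)])
  moreover have "cross3 (e s) (?k *\<^sub>R gvec e s - e s) = - ?k *\<^sub>R tvec e s"
    using orthonormal_cross3(3)[OF frame(1,2,3)]
    by (simp add: Cross3.right_diff_distrib cross_mult_right gvec_def)
  ultimately have "(gvec e has_vector_derivative - ?k *\<^sub>R tvec e s) (at s)"
    using t' by (simp add: gvec_def[abs_def])
  with t' show "vderiv (tvec e) s = ?k *\<^sub>R gvec e s - e s
      \<and> vderiv (gvec e) s = - ?k *\<^sub>R tvec e s"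
    using vector_derivative_at by blast
qed

lemma big_Delta_eq_inner: "big_Delta c e s = vderiv c s \<bullet> gvec e s"
  by (simp add: big_Delta_def gvec_def dot_cross_det)

section \<open>The offset in terms of the first frame\<close>

lemma bertrand_offset_frame:
  assumes "ruled_surface I c e" "bertrand_offset I c e I\<^sub>1 c\<^sub>1 e\<^sub>1 \<sigma>"
    and "offset_dual_angle I c e c\<^sub>1 e\<^sub>1 \<sigma> \<theta> \<theta>'" "s \<in> I"
  shows "tvec e\<^sub>1 (\<sigma> s) = tvec e s"
    and "e\<^sub>1 (\<sigma> s) = cos (\<theta> s) *\<^sub>R e s - sin (\<theta> s) *\<^sub>R gvec e s"
    and "gvec e\<^sub>1 (\<sigma> s) = sin (\<theta> s) *\<^sub>R e s + cos (\<theta> s) *\<^sub>R gvec e s"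
proof -
  note frame = ruled_surface_frame[OF assms(1,4)]
  show t: "tvec e\<^sub>1 (\<sigma> s) = tvec e s"
    using assms(2,4) by (simp add: bertrand_offset_def dual_t_def dual_line_def)
  show e: "e\<^sub>1 (\<sigma> s) = cos (\<theta> s) *\<^sub>R e s - sin (\<theta> s) *\<^sub>R gvec e s"
    using assms(3,4)
    by (simp add: offset_dual_angle_def dual_e_def dual_g_def dual_line_def dual_ext_def
        dual_scale_def minus_dual_def)
  have "cross3 (gvec e s) (tvec e s) = - e s"
    using orthonormal_cross3(2)[OF frame(1,2,3)] cross_skew[of "gvec e s" "tvec e s"]
    by (simp add: gvec_def)
  then show "gvec e\<^sub>1 (\<sigma> s) = sin (\<theta> s) *\<^sub>R e s + cos (\<theta> s) *\<^sub>R gvec e s"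
    unfolding gvec_def[of e\<^sub>1] t e
    by (simp add: Cross3.left_diff_distrib cross_mult_left gvec_def[symmetric])
qed

text \<open>
  The real parts of the offset relations fix the directions; the moments fix the striction point.
  From \<open>t\<^sub>1 = t\<close> as dual vectors, \<open>c\<^sub>1 - c = \<lambda> t\<close>, so the moment \<open>c\<^sub>1 \<times> e\<^sub>1\<close> differs from
  \<open>c \<times> e\<^sub>1\<close> by \<open>\<lambda> (t \<times> e\<^sub>1) = - \<lambda> g\<^sub>1\<close>; by the relation for the dual \<open>e\<^sub>1\<close>, the difference is
  \<open>- \<theta>' g\<^sub>1\<close>.
\<close>

lemma bertrand_offset_striction_line:
  assumes "ruled_surface I c e" "ruled_surface I\<^sub>1 c\<^sub>1 e\<^sub>1"
    and "bertrand_offset I c e I\<^sub>1 c\<^sub>1 e\<^sub>1 \<sigma>"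
    and "offset_dual_angle I c e c\<^sub>1 e\<^sub>1 \<sigma> \<theta> \<theta>'" "s \<in> I"
  shows "c\<^sub>1 (\<sigma> s) = c s + \<theta>' s *\<^sub>R tvec e s"
proof -
  note frame = ruled_surface_frame[OF assms(1,5)]
  note offset = bertrand_offset_frame[OF assms(1,3,4,5)]
  have "\<sigma> s \<in> I\<^sub>1"
    using assms(3,5) by (auto simp: bertrand_offset_def bij_betw_def)
  note frame1 = ruled_surface_frame[OF assms(2) this]
  define x where "x = c\<^sub>1 (\<sigma> s) - c s"
  have "cross3 (c\<^sub>1 (\<sigma> s)) (tvec e s) = cross3 (c s) (tvec e s)"
    using assms(3,5) by (auto simp: bertrand_offset_def dual_t_def dual_line_def)
  then have x: "x = (x \<bullet> tvec e s) *\<^sub>R tvec e s"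
    using frame(2) by (intro parallel_if_cross3_eq_0) (simp_all add: x_def Cross3.left_diff_distrib)
  have trig_deriv: "deriv cos (\<theta> s) = - sin (\<theta> s)" "deriv sin (\<theta> s) = cos (\<theta> s)"
    by (auto intro: DERIV_imp_deriv DERIV_cos DERIV_sin)
  have "du_part (dual_e c\<^sub>1 e\<^sub>1 (\<sigma> s)) =
      du_part (dual_ext cos (Dual (\<theta> s) (\<theta>' s)) *\<^sub>D dual_e c e s
        - dual_ext sin (Dual (\<theta> s) (\<theta>' s)) *\<^sub>D dual_g c e s)"
    using assms(4,5) by (simp add: offset_dual_angle_def)
  then have "cross3 (c\<^sub>1 (\<sigma> s)) (e\<^sub>1 (\<sigma> s)) =
      cos (\<theta> s) *\<^sub>R cross3 (c s) (e s) - sin (\<theta> s) *\<^sub>R cross3 (c s) (gvec e s)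
      - \<theta>' s *\<^sub>R gvec e\<^sub>1 (\<sigma> s)"
    by (simp add: trig_deriv dual_e_def dual_g_def dual_line_def dual_ext_def
        dual_scale_def minus_dual_def offset(3) algebra_simps)
  also have "\<dots> = cross3 (c s) (e\<^sub>1 (\<sigma> s)) - \<theta>' s *\<^sub>R gvec e\<^sub>1 (\<sigma> s)"
    by (simp add: offset(2) Cross3.right_diff_distrib cross_mult_right)
  finally have "cross3 x (e\<^sub>1 (\<sigma> s)) = - \<theta>' s *\<^sub>R gvec e\<^sub>1 (\<sigma> s)"
    by (simp add: x_def Cross3.left_diff_distrib)
  moreover have "cross3 x (e\<^sub>1 (\<sigma> s)) = - (x \<bullet> tvec e s) *\<^sub>R gvec e\<^sub>1 (\<sigma> s)"
    using offset(1) by (subst x) (simp add: cross_mult_left gvec_def cross_skew[of "tvec e s"])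
  moreover have "gvec e\<^sub>1 (\<sigma> s) \<noteq> 0"
    using frame1(4) by auto
  ultimately have "x \<bullet> tvec e s = \<theta>' s"
    by simp
  with x have "x = \<theta>' s *\<^sub>R tvec e s"
    by simp
  then show ?thesis
    by (simp add: x_def algebra_simps)
qed

text \<open>
  The factor \<open>\<theta>'\<close> is the scalar product of the differentiable curves \<open>c\<^sub>1 \<circ> \<sigma> - c\<close> and \<open>t\<close>, which
  is what makes the relation between the striction lines differentiable term by term.
\<close>

lemma bertrand_offset_derivs:
  assumes "ruled_surface I c e" "ruled_surface I\<^sub>1 c\<^sub>1 e\<^sub>1"
    and "bertrand_offset I c e I\<^sub>1 c\<^sub>1 e\<^sub>1 \<sigma>"
    and "offset_dual_angle I c e c\<^sub>1 e\<^sub>1 \<sigma> \<theta> \<theta>'" "s \<in> I"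
  shows "deriv \<sigma> s *\<^sub>R vderiv (tvec e\<^sub>1) (\<sigma> s) = vderiv (tvec e) s"
    and "\<exists>m. deriv \<sigma> s *\<^sub>R vderiv c\<^sub>1 (\<sigma> s) =
          vderiv c s + \<theta>' s *\<^sub>R vderiv (tvec e) s + m *\<^sub>R tvec e s"
proof -
  have I: "open I"
    using assms(1) by (simp add: ruled_surface_def)
  note frame = ruled_surface_frame[OF assms(1,5)]
  have "\<sigma> s \<in> I\<^sub>1"
    using assms(3,5) by (auto simp: bertrand_offset_def bij_betw_def)
  note frame1 = ruled_surface_frame[OF assms(2) this]
  have \<sigma>: "(\<sigma> has_vector_derivative deriv \<sigma> s) (at s)"
    using assms(3,5)
    by (simp add: bertrand_offset_def field_differentiable_derivI
        flip: has_real_derivative_iff_has_vector_derivative)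
  have "(tvec e has_vector_derivative deriv \<sigma> s *\<^sub>R vderiv (tvec e\<^sub>1) (\<sigma> s)) (at s)"
    using has_vector_derivative_transform_within_open[OF vector_diff_chain_at[OF \<sigma> frame1(9)] I assms(5)]
      bertrand_offset_frame(1)[OF assms(1,3,4)] by simp
  then show "deriv \<sigma> s *\<^sub>R vderiv (tvec e\<^sub>1) (\<sigma> s) = vderiv (tvec e) s"
    using frame(9) vector_derivative_unique_at by blast
  have c1: "((\<lambda>x. c\<^sub>1 (\<sigma> x)) has_vector_derivative deriv \<sigma> s *\<^sub>R vderiv c\<^sub>1 (\<sigma> s)) (at s)"
    using vector_diff_chain_at[OF \<sigma> frame1(7)] by (simp add: o_def)
  have striction: "c\<^sub>1 (\<sigma> x) = c x + \<theta>' x *\<^sub>R tvec e x" if "x \<in> I" for x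
    using bertrand_offset_striction_line[OF assms(1-4) that] .
  obtain m where "((\<lambda>x. (c\<^sub>1 (\<sigma> x) - c x) \<bullet> tvec e x) has_vector_derivative m) (at s)"
    using bounded_bilinear.has_vector_derivative[OF bounded_bilinear_inner
        has_vector_derivative_diff[OF c1 frame(7)] frame(9)] by blast
  then have "(\<theta>' has_vector_derivative m) (at s)"
    by (rule has_vector_derivative_transform_within_open[OF _ I assms(5)])
      (simp add: striction ruled_surface_frame(2)[OF assms(1)])
  then have "((\<lambda>x. c x + \<theta>' x *\<^sub>R tvec e x) has_vector_derivative
      vderiv c s + (\<theta>' s *\<^sub>R vderiv (tvec e) s + m *\<^sub>R tvec e s)) (at s)"
    by (intro has_vector_derivative_add frame(7) has_vector_derivative_scaleR frame(9))
      (simp add: has_real_derivative_iff_has_vector_derivative)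
  then have "((\<lambda>x. c\<^sub>1 (\<sigma> x)) has_vector_derivative
      vderiv c s + (\<theta>' s *\<^sub>R vderiv (tvec e) s + m *\<^sub>R tvec e s)) (at s)"
    by (rule has_vector_derivative_transform_within_open[OF _ I assms(5)]) (simp add: striction)
  then show "\<exists>m. deriv \<sigma> s *\<^sub>R vderiv c\<^sub>1 (\<sigma> s) =
      vderiv c s + \<theta>' s *\<^sub>R vderiv (tvec e) s + m *\<^sub>R tvec e s"
    using vector_derivative_unique_at[OF c1] by (metis add.assoc)
qed

section \<open>The dual conical curvature of the offset\<close>

theorem theorem4p7:
  fixes I I\<^sub>1 :: "real set"
    and c e c\<^sub>1 e\<^sub>1 :: "real \<Rightarrow> real ^ 3"
    and \<sigma> \<theta> \<theta>' :: "real \<Rightarrow> real"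
  assumes "ruled_surface I c e"
    and "ruled_surface I\<^sub>1 c\<^sub>1 e\<^sub>1"
    and "bertrand_offset I c e I\<^sub>1 c\<^sub>1 e\<^sub>1 \<sigma>"
    and "offset_dual_angle I c e c\<^sub>1 e\<^sub>1 \<sigma> \<theta> \<theta>'"
  shows "\<forall>s\<in>I.
    let r = deriv (inv_into I \<sigma>) (\<sigma> s);
        \<gamma> = conical_curvature e s;
        \<Delta> = big_Delta c e s;
        \<delta> = small_delta c e s
    in dual_conical_curvature c\<^sub>1 e\<^sub>1 (\<sigma> s) =
       Dual
         (r * (\<gamma> * cos (\<theta> s) - sin (\<theta> s)))
         (r * ((r * cos (\<theta> s) * (sin (\<theta> s) - \<gamma> * cos (\<theta> s)) - sin (\<theta> s)) * \<Delta>
             + (cos (\<theta> s) - r * sin (\<theta> s) * (\<gamma> * cos (\<theta> s) - sin (\<theta> s))) * \<delta>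
             - (r * (\<gamma> * cos (\<theta> s) - sin (\<theta> s))^2 + cos (\<theta> s) + \<gamma> * sin (\<theta> s)) * \<theta>' s))"
proof
  fix s assume s: "s \<in> I"
  note frame = ruled_surface_frame[OF assms(1) s]
  note offset = bertrand_offset_frame[OF assms(1,3,4) s]
  have s1: "\<sigma> s \<in> I\<^sub>1"
    using assms(3) s by (auto simp: bertrand_offset_def bij_betw_def)
  define r where "r = deriv (inv_into I \<sigma>) (\<sigma> s)"
  have nz: "deriv \<sigma> s \<noteq> 0"
    using assms(3) s by (simp add: bertrand_offset_def)
  have r: "r = inverse (deriv \<sigma> s)"
    unfolding r_def using assms(1,3) s nz
    by (intro deriv_inv_into_open) (auto simp: ruled_surface_def bertrand_offset_def bij_betw_def)
  have t1': "vderiv (tvec e\<^sub>1) (\<sigma> s) = r *\<^sub>R vderiv (tvec e) s"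
    using nz by (simp add: r flip: bertrand_offset_derivs(1)[OF assms s])
  obtain m where "deriv \<sigma> s *\<^sub>R vderiv c\<^sub>1 (\<sigma> s) =
      vderiv c s + \<theta>' s *\<^sub>R vderiv (tvec e) s + m *\<^sub>R tvec e s"
    using bertrand_offset_derivs(2)[OF assms s] by blast
  from arg_cong[OF this, of "\<lambda>x. r *\<^sub>R x"]
  have c1': "vderiv c\<^sub>1 (\<sigma> s) =
      r *\<^sub>R (vderiv c s + \<theta>' s *\<^sub>R vderiv (tvec e) s + m *\<^sub>R tvec e s)"
    using nz by (simp add: r)
  note invariants = conical_curvature_eq_inner[OF assms(1) s] big_Delta_eq_inner
    small_delta_def
  have te: "tvec e s \<bullet> e s = 0" and tg: "tvec e s \<bullet> gvec e s = 0"
    using frame(3) by (simp_all add: inner_commute gvec_def dot_cross_self)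
  have \<gamma>1: "conical_curvature e\<^sub>1 (\<sigma> s) =
      r * (conical_curvature e s * cos (\<theta> s) - sin (\<theta> s))"
    unfolding conical_curvature_eq_inner[OF assms(2) s1] t1' offset(3) invariants
    using frame(6) by (simp add: inner_add_right algebra_simps)
  have \<delta>1: "small_delta c\<^sub>1 e\<^sub>1 (\<sigma> s) =
      r * ((small_delta c e s - \<theta>' s) * cos (\<theta> s)
         - (big_Delta c e s + \<theta>' s * conical_curvature e s) * sin (\<theta> s))"
    unfolding invariants c1' offset(2)
    using frame(6) te tg by (simp add: inner_add_left inner_diff_right algebra_simps)
  have \<Delta>1: "big_Delta c\<^sub>1 e\<^sub>1 (\<sigma> s) =
      r * ((small_delta c e s - \<theta>' s) * sin (\<theta> s)
         + (big_Delta c e s + \<theta>' s * conical_curvature e s) * cos (\<theta> s))"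
    unfolding invariants c1' offset(3)
    using frame(6) te tg by (simp add: inner_add_left inner_add_right algebra_simps)
  show "let r = deriv (inv_into I \<sigma>) (\<sigma> s);
        \<gamma> = conical_curvature e s;
        \<Delta> = big_Delta c e s;
        \<delta> = small_delta c e s
    in dual_conical_curvature c\<^sub>1 e\<^sub>1 (\<sigma> s) =
       Dual
         (r * (\<gamma> * cos (\<theta> s) - sin (\<theta> s)))
         (r * ((r * cos (\<theta> s) * (sin (\<theta> s) - \<gamma> * cos (\<theta> s)) - sin (\<theta> s)) * \<Delta>
             + (cos (\<theta> s) - r * sin (\<theta> s) * (\<gamma> * cos (\<theta> s) - sin (\<theta> s))) * \<delta>
             - (r * (\<gamma> * cos (\<theta> s) - sin (\<theta> s))^2 + cos (\<theta> s) + \<gamma> * sin (\<theta> s)) * \<theta>' s))"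
    unfolding Let_def r_def[symmetric] dual_conical_curvature_def \<gamma>1 \<delta>1 \<Delta>1
    by (simp add: algebra_simps power2_eq_square)
qed

end
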